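(* Let $a\in\mathbb{U}$, $b\in(-1,1)$, and let $h$ be a real-valued harmonic function from the unit disk $\mathbb{U}$ into $(-1,1)$ with $h(a)=b$. Then for all $z\in\mathbb{U}$ $$h(z)\le\frac4\pi\arctan\left(\frac{1+|\varphi_a(z)|}{1-|\varphi_a(z)|}\tan\frac{\alpha(|b|)}{2}\right)-1,$$ and $$|(dh)_a|\le\frac4\pi\,\frac{\sin\alpha(|b|)}{1-|a|^2}.$$
   Context: $\mathbb{U}$ is the open unit disk in $\mathbb{C}$; $\varphi_a(z)=\frac{a-z}{1-\overline{a}z}$; $\alpha(t)=\frac{\pi}{2}(t+1)$; $|(dh)_a|=|\nabla h(a)|$ is the norm of the differential of $h$ at $a$. *)

theory Defs
  imports "HOL-Analysis.Analysis"
begin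

definition dir_deriv :: "'a::real_normed_vector \<Rightarrow> ('a \<Rightarrow> real) \<Rightarrow> 'a \<Rightarrow> real" where
  "dir_deriv v f x = frechet_derivative f (at x) v"

definition C1_on :: "('a::euclidean_space \<Rightarrow> real) \<Rightarrow> 'a set \<Rightarrow> bool" where
  "C1_on f S \<longleftrightarrow>
     (\<forall>x\<in>S. f differentiable (at x)) \<and>
     (\<forall>v\<in>Basis. continuous_on S (dir_deriv v f))"

definition C2_on :: "('a::euclidean_space \<Rightarrow> real) \<Rightarrow> 'a set \<Rightarrow> bool" where
  "C2_on f S \<longleftrightarrow> C1_on f S \<and> (\<forall>v\<in>Basis. C1_on (dir_deriv v f) S)"

definition laplacian :: "('a::euclidean_space \<Rightarrow> real) \<Rightarrow> 'a \<Rightarrow> real" where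
  "laplacian f x = (\<Sum>v\<in>Basis. dir_deriv v (dir_deriv v f) x)"

(* On the complex plane, Basis = {1, \<i>}, so the laplacian is the usual f_xx + f_yy. *)
definition harmonic_on :: "('a::euclidean_space \<Rightarrow> real) \<Rightarrow> 'a set \<Rightarrow> bool" where
  "harmonic_on f S \<longleftrightarrow> open S \<and> C2_on f S \<and> (\<forall>x\<in>S. laplacian f x = 0)"

definition disk_involution :: "complex \<Rightarrow> complex \<Rightarrow> complex" where
  "disk_involution a z = (a - z) / (1 - cnj a * z)"

definition strip_angle :: "real \<Rightarrow> real" where
  "strip_angle t = pi / 2 * (t + 1)"

end

theory Submission
  imports Defs "HOL-Complex_Analysis.Riemann_Mapping"
begin

text \<open>
  On the disk a harmonic function is the real part of a holomorphic function \<open>F\<close>, here chosen with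
  \<open>F a = b\<close>. Since \<open>h\<close> takes values in \<open>(-1, 1)\<close>, \<open>F\<close> maps into a vertical strip, and
  \<open>E z = exp (\<i> pi / 2 * (F z + 1))\<close> opens that strip to the upper half plane: the angle of \<open>E z\<close> is
  \<open>strip_angle (h z)\<close>, and \<open>E a\<close> lies on the unit circle. Both estimates are the Schwarz-Pick lemma
  for \<open>E\<close> (\<open>schwarz_pick_half_plane\<close>), in its metric and in its infinitesimal form.

  The metric form confines \<open>E z\<close> to the pseudo-hyperbolic disk of radius \<open>cmod (disk_involution a z)\<close>
  about \<open>E a\<close>. How large can an angle in that disk be? Two points on the rays at angles \<open>\<theta>\<close> and \<open>\<alpha>\<close>
  are closest, in the pseudo-hyperbolic distance, when they have the same modulus; their distance is
  then \<open>\<bar>sin ((\<theta> - \<alpha>) / 2)\<bar> / sin ((\<theta> + \<alpha>) / 2)\<close>, and solving for \<open>tan (\<theta> / 2)\<close> gives the bound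
  on \<open>h z\<close> (\<open>angle_bound_in_pseudohyperbolic_disk\<close>). The infinitesimal form reads
  \<open>cmod (deriv E a) * (1 - (cmod a)\<^sup>2) \<le> 2 * Im (E a)\<close>, where \<open>cmod (deriv E a)\<close> is \<open>pi / 2\<close> times
  \<open>cmod (deriv F a)\<close> and \<open>Im (E a) = sin (strip_angle b)\<close>; and the differential of \<open>h = Re F\<close> at \<open>a\<close> is
  \<open>v \<mapsto> Re (deriv F a * v)\<close>, so its norm is at most \<open>cmod (deriv F a)\<close>. Replacing \<open>b\<close> by \<open>\<bar>b\<bar>\<close> weakens
  the first bound and leaves the second unchanged.

  The function \<open>F\<close> is a primitive of \<open>h\<^sub>x - \<i> h\<^sub>y\<close>. The Cauchy-Riemann equations for this function are
  Laplace's equation and the symmetry of the mixed second partial derivatives; the latter is derived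
  by expressing a second difference of \<open>h\<close> in two ways through the mean value theorem.
\<close>

section \<open>Symmetry of second partial derivatives\<close>

lemma DERIV_along_line:
  assumes "f differentiable (at (y + s *\<^sub>R v))"
  shows "((\<lambda>s. f (y + s *\<^sub>R v)) has_real_derivative dir_deriv v f (y + s *\<^sub>R v)) (at s)"
proof -
  let ?D = "frechet_derivative f (at (y + s *\<^sub>R v))"
  have D: "(f has_derivative ?D) (at (y + s *\<^sub>R v))"
    using assms by (simp add: frechet_derivative_works)
  have "((\<lambda>s. f (y + s *\<^sub>R v)) has_derivative (\<lambda>t. ?D (t *\<^sub>R v))) (at s)"
    by (rule has_derivative_compose[of "\<lambda>s. y + s *\<^sub>R v", OF _ D])
       (auto intro!: derivative_eq_intros)
  moreover have "(\<lambda>t. ?D (t *\<^sub>R v)) = (*) (dir_deriv v f (y + s *\<^sub>R v))"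
    using linear_scale[OF has_derivative_linear[OF D]]
    by (auto simp: dir_deriv_def mult.commute)
  ultimately show ?thesis
    by (simp add: has_field_derivative_def)
qed

text \<open>
  The left-hand side is symmetric in \<open>u\<close> and \<open>v\<close>. Applying this once as stated and once with the
  directions swapped compares the two mixed partial derivatives at nearby points.
\<close>
lemma double_difference_mean_value:
  assumes f: "\<And>y. y \<in> ball x e \<Longrightarrow> f differentiable (at y)"
    and fu: "\<And>y. y \<in> ball x e \<Longrightarrow> dir_deriv u f differentiable (at y)"
    and uv: "norm u = 1" "norm v = 1" and t: "0 < t" "2 * t < e"
  shows "\<exists>y. dist x y \<le> 2 * t \<and>
    f (x + t *\<^sub>R u + t *\<^sub>R v) - f (x + t *\<^sub>R u) - f (x + t *\<^sub>R v) + f x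
      = t * t * dir_deriv v (dir_deriv u f) y"
proof -
  \<comment> \<open>The parallelogram spanned by \<open>t u\<close> and \<open>t v\<close> at \<open>x\<close> stays inside the ball.\<close>
  have near: "dist x (x + s *\<^sub>R u + r *\<^sub>R v) \<le> 2 * t" if "0 \<le> s" "s \<le> t" "0 \<le> r" "r \<le> t" for s r
  proof -
    have "norm (s *\<^sub>R u + r *\<^sub>R v) \<le> s + r"
      using norm_triangle_ineq[of "s *\<^sub>R u" "r *\<^sub>R v"] uv that by simp
    then show ?thesis
      using that norm_minus_cancel[of "s *\<^sub>R u + r *\<^sub>R v"]
      by (simp add: dist_norm algebra_simps)
  qed
  have inb: "x + s *\<^sub>R u + r *\<^sub>R v \<in> ball x e" if "0 \<le> s" "s \<le> t" "0 \<le> r" "r \<le> t" for s r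
    using near[OF that] t by auto
  define g where "g s = f ((x + t *\<^sub>R v) + s *\<^sub>R u) - f (x + s *\<^sub>R u)" for s
  have "\<exists>s. 0 < s \<and> s < t \<and> g t - g 0 =
      (t - 0) * (dir_deriv u f ((x + t *\<^sub>R v) + s *\<^sub>R u) - dir_deriv u f (x + s *\<^sub>R u))"
  proof (rule MVT2)
    fix s assume s: "0 \<le> s" "s \<le> t"
    show "DERIV g s :> dir_deriv u f ((x + t *\<^sub>R v) + s *\<^sub>R u) - dir_deriv u f (x + s *\<^sub>R u)"
      unfolding g_def
      using inb[OF s, of t] inb[OF s, of 0] t
      by (intro DERIV_diff DERIV_along_line f) (auto simp: algebra_simps)
  qed (use t in auto)
  then obtain s where s: "0 < s" "s < t"
    and gs: "g t - g 0 = t * (dir_deriv u f ((x + t *\<^sub>R v) + s *\<^sub>R u) - dir_deriv u f (x + s *\<^sub>R u))"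
    by auto
  have "\<exists>r. 0 < r \<and> r < t \<and>
      dir_deriv u f ((x + s *\<^sub>R u) + t *\<^sub>R v) - dir_deriv u f ((x + s *\<^sub>R u) + 0 *\<^sub>R v)
      = (t - 0) * dir_deriv v (dir_deriv u f) ((x + s *\<^sub>R u) + r *\<^sub>R v)"
    by (rule MVT2) (use s t in \<open>auto intro!: DERIV_along_line fu inb\<close>)
  then obtain r where r: "0 < r" "r < t" and
    gr: "dir_deriv u f (x + s *\<^sub>R u + t *\<^sub>R v) - dir_deriv u f (x + s *\<^sub>R u)
      = t * dir_deriv v (dir_deriv u f) (x + s *\<^sub>R u + r *\<^sub>R v)"
    by auto
  have "g t - g 0 = t * t * dir_deriv v (dir_deriv u f) (x + s *\<^sub>R u + r *\<^sub>R v)"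
    using gs gr by (simp add: algebra_simps)
  moreover have "g t - g 0 = f (x + t *\<^sub>R u + t *\<^sub>R v) - f (x + t *\<^sub>R u) - f (x + t *\<^sub>R v) + f x"
    by (simp add: g_def algebra_simps)
  moreover have "dist x (x + s *\<^sub>R u + r *\<^sub>R v) \<le> 2 * t"
    by (rule near) (use s r in auto)
  ultimately show ?thesis
    by metis
qed

lemma C2_on_mixed_partials_commute:
  assumes f: "C2_on f S" and S: "open S" "x \<in> S" and uv: "u \<in> Basis" "v \<in> Basis"
  shows "dir_deriv u (dir_deriv v f) x = dir_deriv v (dir_deriv u f) x"
proof (rule ccontr)
  let ?p = "dir_deriv u (dir_deriv v f)" and ?q = "dir_deriv v (dir_deriv u f)"
  assume "?p x \<noteq> ?q x"
  \<comment> \<open>Half the gap: values within \<open>d\<close> of the two partial derivatives at \<open>x\<close> cannot coincide.\<close>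
  define d where "d = \<bar>?p x - ?q x\<bar> / 2"
  have d: "d > 0"
    using \<open>?p x \<noteq> ?q x\<close> by (simp add: d_def)
  have df: "f differentiable (at y)" if "y \<in> S" for y
    using f that by (auto simp: C2_on_def C1_on_def)
  have ddf: "dir_deriv w f differentiable (at y)" if "y \<in> S" "w \<in> Basis" for y w
    using f that by (auto simp: C2_on_def C1_on_def)
  have "continuous_on S ?p" "continuous_on S ?q"
    using f uv by (auto simp: C2_on_def C1_on_def)
  then have "isCont ?p x" "isCont ?q x"
    using S continuous_on_eq_continuous_at by blast+
  then obtain e1 e2 where e12: "e1 > 0" "e2 > 0"
    and e1: "\<And>y. dist y x < e1 \<Longrightarrow> dist (?p y) (?p x) < d"
    and e2: "\<And>y. dist y x < e2 \<Longrightarrow> dist (?q y) (?q x) < d"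
    using d unfolding continuous_at_eps_delta by metis
  obtain e3 where e3: "e3 > 0" "ball x e3 \<subseteq> S"
    using S open_contains_ball by blast
  define e where "e = min e1 (min e2 e3)"
  have e: "e > 0" "e \<le> e1" "e \<le> e2" "e \<le> e3"
    using e12 e3 by (auto simp: e_def)
  define t where "t = e / 3"
  have t: "0 < t" "2 * t < e"
    using e by (auto simp: t_def)
  have inS: "y \<in> S" if "y \<in> ball x e" for y
    using that e e3 by auto
  obtain y where y: "dist x y \<le> 2 * t"
    and py: "f (x + t *\<^sub>R v + t *\<^sub>R u) - f (x + t *\<^sub>R v) - f (x + t *\<^sub>R u) + f x = t * t * ?p y"
    using double_difference_mean_value[of x e f v u t] df ddf inS uv t by auto
  obtain z where z: "dist x z \<le> 2 * t"
    and qz: "f (x + t *\<^sub>R u + t *\<^sub>R v) - f (x + t *\<^sub>R u) - f (x + t *\<^sub>R v) + f x = t * t * ?q z"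
    using double_difference_mean_value[of x e f u v t] df ddf inS uv t by auto
  have swap: "f (x + t *\<^sub>R u + t *\<^sub>R v) = f (x + t *\<^sub>R v + t *\<^sub>R u)"
    by (rule arg_cong[where f = f]) (simp add: algebra_simps)
  have "t * t * ?p y = t * t * ?q z"
    unfolding py[symmetric] qz[symmetric] swap by simp
  then have "?p y = ?q z"
    using t by simp
  moreover have "dist (?p y) (?p x) < d"
    using y t e by (intro e1) (simp add: dist_commute)
  moreover have "dist (?q z) (?q x) < d"
    using z t e by (intro e2) (simp add: dist_commute)
  ultimately show False
    unfolding d_def dist_real_def by argo
qed

section \<open>Harmonic functions as real parts\<close>

lemma has_derivative_dir_deriv_complex:
  fixes f :: "complex \<Rightarrow> real"
  assumes "f differentiable (at z)"
  shows "(f has_derivative (\<lambda>v. Re v * dir_deriv 1 f z + Im v * dir_deriv \<i> f z)) (at z)"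
proof -
  let ?D = "frechet_derivative f (at z)"
  have D: "(f has_derivative ?D) (at z)"
    using assms by (simp add: frechet_derivative_works)
  have lin: "linear ?D"
    by (rule has_derivative_linear[OF D])
  have "?D v = Re v * dir_deriv 1 f z + Im v * dir_deriv \<i> f z" for v
  proof -
    have "?D v = ?D (Re v *\<^sub>R 1 + Im v *\<^sub>R \<i>)"
      by (rule arg_cong[where f = ?D]) (simp add: complex_eq_iff)
    also have "\<dots> = Re v * ?D 1 + Im v * ?D \<i>"
      by (simp only: linear_add[OF lin] linear_scale[OF lin] real_scaleR_def)
    finally show ?thesis
      by (simp add: dir_deriv_def)
  qed
  then show ?thesis
    using D by (metis (no_types, lifting) ext)
qed

text \<open>
  Convexity of the domain provides a primitive of \<open>h\<^sub>x - \<i> h\<^sub>y\<close>; its real part has the same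
  differential as \<open>h\<close>, so it equals \<open>h\<close> up to a constant.
\<close>
lemma harmonic_on_imp_Re_holomorphic:
  fixes h :: "complex \<Rightarrow> real"
  assumes h: "harmonic_on h S" and S: "convex S" "a \<in> S"
  obtains F where "F holomorphic_on S" "\<And>z. z \<in> S \<Longrightarrow> Re (F z) = h z" "F a = of_real (h a)"
proof -
  have opS: "open S" and C2: "C2_on h S" and lap: "\<And>z. z \<in> S \<Longrightarrow> laplacian h z = 0"
    using h by (auto simp: harmonic_on_def)
  have dh: "h differentiable (at z)" if "z \<in> S" for z
    using C2 that by (auto simp: C2_on_def C1_on_def)
  have ddh: "dir_deriv v h differentiable (at z)" if "z \<in> S" "v \<in> {1, \<i>}" for z v
    using C2 that by (auto simp: C2_on_def C1_on_def Basis_complex_def)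
  define G where "G z = Complex (dir_deriv 1 h z) (- dir_deriv \<i> h z)" for z
  have "G field_differentiable at z" if z: "z \<in> S" for z
  proof -
    define p q where "p = dir_deriv 1 (dir_deriv 1 h) z" and "q = dir_deriv \<i> (dir_deriv 1 h) z"
    have sym: "dir_deriv 1 (dir_deriv \<i> h) z = q"
      unfolding q_def by (rule C2_on_mixed_partials_commute[OF C2 opS z]) (auto simp: Basis_complex_def)
    have "dir_deriv \<i> (dir_deriv \<i> h) z = - p"
      using lap[OF z] by (simp add: laplacian_def Basis_complex_def p_def)
    then have hy: "(dir_deriv \<i> h has_derivative (\<lambda>v. Re v * q + Im v * (- p))) (at z)"
      using has_derivative_dir_deriv_complex[OF ddh[OF z, of \<i>]] sym by simp
    have hx: "(dir_deriv 1 h has_derivative (\<lambda>v. Re v * p + Im v * q)) (at z)"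
      using has_derivative_dir_deriv_complex[OF ddh[OF z, of 1]] by (simp add: p_def q_def)
    \<comment> \<open>The real differential of \<open>G\<close> is multiplication by a complex number, that is, the
      Cauchy-Riemann equations hold.\<close>
    have "(G has_derivative (*) (Complex p (- q))) (at z)"
      unfolding has_derivative_componentwise_within[of G]
      using hx has_derivative_minus[OF hy]
      by (simp add: Basis_complex_def G_def algebra_simps)
    then show ?thesis
      unfolding field_differentiable_def has_field_derivative_def by blast
  qed
  then have "G holomorphic_on S"
    by (simp add: holomorphic_on_def field_differentiable_at_within)
  then obtain F0 where F0: "\<And>z. z \<in> S \<Longrightarrow> (F0 has_field_derivative G z) (at z)"
    using holomorphic_convex_primitive'[OF S(1) opS] at_within_open[OF _ opS] by metis
  define F where "F z = F0 z - F0 a + of_real (h a)" for z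
  have F: "(F has_field_derivative G z) (at z)" if "z \<in> S" for z
    unfolding F_def using F0[OF that] by (auto intro!: derivative_eq_intros)
  have "Re (F z) = h z" if "z \<in> S" for z
  proof -
    have "Re (F z) - h z = Re (F a) - h a"
    proof (rule has_derivative_zero_unique[OF S(1) _ that S(2)])
      fix w assume w: "w \<in> S"
      have "(F has_derivative (*) (G w)) (at w)"
        using F[OF w] by (simp add: has_field_derivative_def)
      then have "((\<lambda>z. Re (F z)) has_derivative (\<lambda>v. Re (G w * v))) (at w)"
        by (rule bounded_linear.has_derivative[OF bounded_linear_Re])
      from has_derivative_diff[OF this has_derivative_dir_deriv_complex[OF dh[OF w]]]
      show "((\<lambda>z. Re (F z) - h z) has_derivative (\<lambda>_. 0)) (at w within S)"
        by (simp add: G_def algebra_simps has_derivative_at_withinI)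
    qed
    then show ?thesis
      by (simp add: F_def)
  qed
  moreover have "F holomorphic_on S"
    using F holomorphic_on_open[OF opS] by blast
  ultimately show ?thesis
    using that by (simp add: F_def)
qed

section \<open>The Schwarz-Pick lemma for the upper half plane\<close>

lemma disk_involution_eq_Moebius: "disk_involution a z = - Moebius_function 0 a z"
  by (simp add: disk_involution_def Moebius_function_simple minus_divide_left)

lemma disk_involution_in_disk:
  "cmod a < 1 \<Longrightarrow> cmod z < 1 \<Longrightarrow> cmod (disk_involution a z) < 1"
  by (simp add: disk_involution_eq_Moebius Moebius_function_norm_lt_1)

lemma one_minus_cnj_mult_nonzero:
  assumes "cmod a < 1" "cmod z < 1"
  shows "1 - cnj a * z \<noteq> 0"
proof
  assume "1 - cnj a * z = 0"
  then have "cmod (cnj a * z) = 1"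
    by simp
  then show False
    using norm_mult_less[of "cnj a" 1 z 1] assms by simp
qed

lemma disk_involution_involutive:
  assumes "cmod a < 1" "cmod z < 1"
  shows "disk_involution a (disk_involution a z) = z"
proof -
  have n: "1 - cnj a * z \<noteq> 0" and m: "1 - cnj a * a \<noteq> 0"
    using one_minus_cnj_mult_nonzero assms by blast+
  have "a - disk_involution a z = z * (1 - cnj a * a) / (1 - cnj a * z)"
    using n by (simp add: disk_involution_def field_simps)
  moreover have "1 - cnj a * disk_involution a z = (1 - cnj a * a) / (1 - cnj a * z)"
    using n by (simp add: disk_involution_def field_simps)
  ultimately show ?thesis
    using n m by (simp add: disk_involution_def[of a "disk_involution a z"])
qed

lemma cmod_less_cnj_distance:
  assumes "Im w > 0" "Im c > 0"
  shows "cmod (w - c) < cmod (w - cnj c)"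
proof -
  have "(Im w - Im c)\<^sup>2 < (Im w + Im c)\<^sup>2"
    using assms by (simp add: power2_eq_square algebra_simps)
  then show ?thesis
    by (simp add: cmod_def)
qed

text \<open>
  Schwarz's lemma for \<open>E\<close> conjugated by two Moebius maps: \<open>disk_involution a\<close> moves the base point \<open>a\<close>
  to the origin, and \<open>w \<mapsto> (w - E a) / (w - cnj (E a))\<close> maps the half plane to the disk with \<open>E a\<close>
  going to the origin.
\<close>
lemma schwarz_pick_half_plane:
  assumes E: "E holomorphic_on ball 0 1" and pos: "\<And>z. cmod z < 1 \<Longrightarrow> Im (E z) > 0"
    and a: "cmod a < 1"
  shows "cmod z < 1 \<Longrightarrow> cmod (E z - E a) \<le> cmod (disk_involution a z) * cmod (E z - cnj (E a))"
    and "cmod (deriv E a) * (1 - (cmod a)\<^sup>2) \<le> 2 * Im (E a)"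
proof -
  let ?c = "E a" and ?\<phi> = "disk_involution a"
  define \<Phi> where "\<Phi> \<zeta> = (E (?\<phi> \<zeta>) - ?c) / (E (?\<phi> \<zeta>) - cnj ?c)" for \<zeta>
  have \<phi>_hol: "?\<phi> holomorphic_on ball 0 1"
    unfolding disk_involution_def
    using one_minus_cnj_mult_nonzero[OF a] by (intro holomorphic_intros) auto
  have \<phi>_in: "?\<phi> ` ball 0 1 \<subseteq> ball 0 1"
    using disk_involution_in_disk[OF a] by auto
  have E\<phi>_hol: "(\<lambda>\<zeta>. E (?\<phi> \<zeta>)) holomorphic_on ball 0 1"
    using holomorphic_on_compose_gen[OF \<phi>_hol E \<phi>_in] by (simp add: o_def)
  have nz: "w - cnj ?c \<noteq> 0" if "Im w > 0" for w
    using that pos[OF a] by (auto simp: complex_eq_iff)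
  have E\<phi>_nz: "E (?\<phi> \<zeta>) - cnj ?c \<noteq> 0" if "cmod \<zeta> < 1" for \<zeta>
    using nz[OF pos[OF disk_involution_in_disk[OF a that]]] .
  have \<Phi>_hol: "\<Phi> holomorphic_on ball 0 1"
    unfolding \<Phi>_def using E\<phi>_nz E\<phi>_hol by (intro holomorphic_intros) auto
  have \<Phi>0: "\<Phi> 0 = 0"
    by (simp add: \<Phi>_def disk_involution_def)
  have \<Phi>_lt: "cmod (\<Phi> \<zeta>) < 1" if "cmod \<zeta> < 1" for \<zeta>
    using cmod_less_cnj_distance[OF pos pos[OF a], of "?\<phi> \<zeta>"] disk_involution_in_disk[OF a that]
      E\<phi>_nz[OF that]
    by (auto simp: \<Phi>_def norm_divide divide_simps)
  show "cmod (E z - ?c) \<le> cmod (?\<phi> z) * cmod (E z - cnj ?c)" if z: "cmod z < 1"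
  proof -
    have "cmod (\<Phi> (?\<phi> z)) \<le> cmod (?\<phi> z)"
      by (rule Schwarz_Lemma(1)[OF \<Phi>_hol \<Phi>0 \<Phi>_lt disk_involution_in_disk[OF a z]])
    then show ?thesis
      using nz[OF pos[OF z]]
      by (simp add: \<Phi>_def disk_involution_involutive[OF a z] norm_divide divide_simps)
  qed
  have "deriv E a * (1 - (cmod a)\<^sup>2) = - (deriv \<Phi> 0 * (2 * \<i> * Im ?c))"
  proof -
    have "(?\<phi> has_field_derivative - (1 - (cmod a)\<^sup>2)) (at 0)"
      unfolding disk_involution_def
      by (auto intro!: derivative_eq_intros simp: mult.commute complex_norm_square[symmetric])
    moreover have "(E has_field_derivative deriv E a) (at (?\<phi> 0))"
      using holomorphic_derivI[OF E, of a] a by (simp add: disk_involution_def)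
    ultimately have E\<phi>: "((\<lambda>\<zeta>. E (?\<phi> \<zeta>)) has_field_derivative deriv E a * - (1 - (cmod a)\<^sup>2)) (at 0)"
      using DERIV_chain2 by blast
    have E\<phi>_diff: "((\<lambda>\<zeta>. E (?\<phi> \<zeta>) - k) has_field_derivative
        deriv E a * - (1 - (cmod a)\<^sup>2)) (at 0)" for k
      using DERIV_diff[OF E\<phi> DERIV_const] by simp
    have cc: "?c - cnj ?c = 2 * \<i> * Im ?c"
      by (simp add: complex_eq_iff)
    have "?c - cnj ?c \<noteq> 0"
      using nz pos a by auto
    then have "(\<Phi> has_field_derivative (deriv E a * - (1 - (cmod a)\<^sup>2)) / (?c - cnj ?c)) (at 0)"
      using DERIV_divide[OF E\<phi>_diff E\<phi>_diff, of "cnj ?c" ?c]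
      unfolding \<Phi>_def by (simp add: disk_involution_def)
    then have "deriv \<Phi> 0 = (deriv E a * - (1 - (cmod a)\<^sup>2)) / (?c - cnj ?c)"
      by (rule DERIV_imp_deriv)
    then show ?thesis
      using \<open>?c - cnj ?c \<noteq> 0\<close> unfolding cc by (simp add: field_simps)
  qed
  then have "cmod (deriv E a * (1 - (cmod a)\<^sup>2)) = cmod (deriv \<Phi> 0) * (2 * Im ?c)"
    using pos[OF a] by (simp add: norm_mult)
  also have "\<dots> \<le> 2 * Im ?c"
    using Schwarz_Lemma(2)[OF \<Phi>_hol \<Phi>0 \<Phi>_lt, of 0] pos[OF a] by (simp add: mult_left_le_one_le)
  also have "cmod (deriv E a * (1 - (cmod a)\<^sup>2)) = cmod (deriv E a) * (1 - (cmod a)\<^sup>2)"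
  proof -
    have "cmod (1 - (of_real (cmod a))\<^sup>2) = 1 - (cmod a)\<^sup>2"
      using a power_le_one[of "cmod a" 2] norm_of_real[of "1 - (cmod a)\<^sup>2", where 'a = complex]
      by simp
    then show ?thesis
      by (simp add: norm_mult)
  qed
  finally show "cmod (deriv E a) * (1 - (cmod a)\<^sup>2) \<le> 2 * Im ?c" .
qed

section \<open>Angles in a pseudo-hyperbolic disk\<close>

lemma cmod_of_real_cis_diff_squared:
  "(cmod (of_real R * cis \<theta> - cis \<beta>))\<^sup>2 = (R - 1)\<^sup>2 + 4 * R * (sin ((\<theta> - \<beta>) / 2))\<^sup>2"
proof -
  have "(cmod (of_real R * cis \<theta> - cis \<beta>))\<^sup>2 = (R * cos \<theta> - cos \<beta>)\<^sup>2 + (R * sin \<theta> - sin \<beta>)\<^sup>2"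
    by (simp add: cmod_power2)
  also have "\<dots> = R\<^sup>2 * ((cos \<theta>)\<^sup>2 + (sin \<theta>)\<^sup>2) + ((cos \<beta>)\<^sup>2 + (sin \<beta>)\<^sup>2)
      - 2 * R * (cos \<theta> * cos \<beta> + sin \<theta> * sin \<beta>)"
    by algebra
  also have "\<dots> = R\<^sup>2 + 1 - 2 * R * cos (\<theta> - \<beta>)"
    by (simp add: cos_diff)
  also have "cos (\<theta> - \<beta>) = 1 - 2 * (sin ((\<theta> - \<beta>) / 2))\<^sup>2"
    using cos_double_sin[of "(\<theta> - \<beta>) / 2"] by (simp only: times_divide_eq_right nonzero_mult_div_cancel_left)
  finally show ?thesis
    by (simp add: power2_eq_square algebra_simps)
qed

text \<open>
  After squaring, both distances contain the term \<open>(R - 1)\<^sup>2\<close>. As \<open>r \<le> 1\<close> it can be cancelled, which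
  amounts to moving the point along its ray to the unit circle; the modulus \<open>R\<close> then drops out.
\<close>
lemma angle_bound_in_pseudohyperbolic_disk:
  assumes \<theta>: "0 < \<theta>" "\<theta> < pi" and \<alpha>: "0 < \<alpha>" "\<alpha> < pi" and R: "R > 0" and r: "0 \<le> r" "r < 1"
    and le: "cmod (of_real R * cis \<theta> - cis \<alpha>) \<le> r * cmod (of_real R * cis \<theta> - cnj (cis \<alpha>))"
  shows "\<theta> \<le> 2 * arctan ((1 + r) / (1 - r) * tan (\<alpha> / 2))"
proof -
  have "r\<^sup>2 \<le> 1"
    using r by (simp add: power_le_one)
  have "(R - 1)\<^sup>2 + 4 * R * (sin ((\<theta> - \<alpha>) / 2))\<^sup>2
      \<le> r\<^sup>2 * ((R - 1)\<^sup>2 + 4 * R * (sin ((\<theta> + \<alpha>) / 2))\<^sup>2)"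
    using power_mono[OF le, of 2]
    by (simp add: cis_cnj power_mult_distrib cmod_of_real_cis_diff_squared)
  also have "\<dots> \<le> (R - 1)\<^sup>2 + r\<^sup>2 * (4 * R * (sin ((\<theta> + \<alpha>) / 2))\<^sup>2)"
    using mult_right_mono[OF \<open>r\<^sup>2 \<le> 1\<close>, of "(R - 1)\<^sup>2"] by (simp add: distrib_left)
  finally have "R * (sin ((\<theta> - \<alpha>) / 2))\<^sup>2 \<le> R * (r * sin ((\<theta> + \<alpha>) / 2))\<^sup>2"
    by (simp add: power_mult_distrib mult.left_commute)
  then have "(sin ((\<theta> - \<alpha>) / 2))\<^sup>2 \<le> (r * sin ((\<theta> + \<alpha>) / 2))\<^sup>2"
    using R by simp
  moreover have "0 \<le> r * sin ((\<theta> + \<alpha>) / 2)"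
    using r \<theta> \<alpha> by (intro mult_nonneg_nonneg sin_ge_zero) auto
  ultimately have "sin ((\<theta> - \<alpha>) / 2) \<le> r * sin ((\<theta> + \<alpha>) / 2)"
    by (rule power2_le_imp_le)
  then have "sin (\<theta> / 2) * cos (\<alpha> / 2) * (1 - r) \<le> (1 + r) * (cos (\<theta> / 2) * sin (\<alpha> / 2))"
    by (simp add: diff_divide_distrib add_divide_distrib sin_diff sin_add algebra_simps)
  moreover have "cos (\<theta> / 2) > 0" "cos (\<alpha> / 2) > 0"
    using \<theta> \<alpha> by (auto intro!: cos_gt_zero)
  ultimately have "tan (\<theta> / 2) \<le> (1 + r) / (1 - r) * tan (\<alpha> / 2)"
    using r by (simp add: tan_def field_simps)
  then have "arctan (tan (\<theta> / 2)) \<le> arctan ((1 + r) / (1 - r) * tan (\<alpha> / 2))"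
    by (rule arctan_monotone')
  moreover have "arctan (tan (\<theta> / 2)) = \<theta> / 2"
    using \<theta> by (intro arctan_tan) auto
  ultimately show ?thesis
    by simp
qed

section \<open>Harmonic functions into an interval\<close>

lemma strip_angle_bounds: "t \<in> {-1<..<1} \<Longrightarrow> 0 < strip_angle t \<and> strip_angle t < pi"
  using mult_strict_left_mono[of "t + 1" 2 "pi / 2"] by (simp add: strip_angle_def)

lemma sin_strip_angle_abs: "sin (strip_angle \<bar>t\<bar>) = sin (strip_angle t)"
  by (simp add: strip_angle_def distrib_left sin_add abs_if)

lemma tan_half_strip_angle_le_abs:
  assumes "t \<in> {-1<..<1}"
  shows "tan (strip_angle t / 2) \<le> tan (strip_angle \<bar>t\<bar> / 2)"
proof -
  have "strip_angle t \<le> strip_angle \<bar>t\<bar>"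
    by (simp add: strip_angle_def mult_left_mono)
  then show ?thesis
    using strip_angle_bounds[OF assms] strip_angle_bounds[of "\<bar>t\<bar>"] assms
    by (intro tan_mono_le) (auto simp: abs_less_iff)
qed

theorem theorem3:
  fixes a :: complex and b :: real and h :: "complex \<Rightarrow> real"
  assumes "a \<in> ball 0 1"
    and "b \<in> {-1<..<1}"
    and "harmonic_on h (ball 0 1)"
    and "h ` ball 0 1 \<subseteq> {-1<..<1}"
    and "h a = b"
  shows "(\<forall>z\<in>ball 0 1.
            h z \<le> 4 / pi * arctan ((1 + cmod (disk_involution a z)) / (1 - cmod (disk_involution a z))
                                    * tan (strip_angle \<bar>b\<bar> / 2)) - 1)
       \<and> onorm (frechet_derivative h (at a)) \<le> 4 / pi * (sin (strip_angle \<bar>b\<bar>) / (1 - (cmod a)\<^sup>2))"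
proof -
  have a: "cmod a < 1"
    using assms(1) by simp
  obtain F where F: "F holomorphic_on ball 0 1"
    and ReF: "\<And>z. z \<in> ball 0 1 \<Longrightarrow> Re (F z) = h z" and Fa: "F a = of_real b"
    using harmonic_on_imp_Re_holomorphic[OF assms(3) convex_ball assms(1)] assms(5) by metis
  define E where "E z = exp (\<i> * of_real (pi / 2) * (F z + 1))" for z
  define R where "R z = exp (- (pi / 2 * Im (F z)))" for z
  have E_polar: "E z = of_real (R z) * cis (strip_angle (h z))" if "cmod z < 1" for z
    using ReF[of z] that
    by (auto simp: E_def R_def strip_angle_def exp_eq_polar mult.commute algebra_simps)
  have Ea: "E a = cis (strip_angle b)"
    using E_polar[OF a] Fa assms(5) by (simp add: R_def)
  have E_hol: "E holomorphic_on ball 0 1"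
    unfolding E_def using F by (intro holomorphic_intros)
  have angle: "0 < strip_angle (h z)" "strip_angle (h z) < pi" if "cmod z < 1" for z
    using strip_angle_bounds[of "h z"] image_subset_iff[THEN iffD1, OF assms(4)] that by auto
  have R: "R z > 0" for z
    by (simp add: R_def)
  have E_pos: "Im (E z) > 0" if "cmod z < 1" for z
    using E_polar[OF that] R[of z] sin_gt_zero[OF angle[OF that]] by simp
  have schwarz_pick: "cmod (E z - E a) \<le> cmod (disk_involution a z) * cmod (E z - cnj (E a))"
    if "cmod z < 1" for z
    by (rule schwarz_pick_half_plane(1)[OF E_hol _ a that]) (rule E_pos)
  have schwarz_pick_deriv: "cmod (deriv E a) * (1 - (cmod a)\<^sup>2) \<le> 2 * Im (E a)"
    by (rule schwarz_pick_half_plane(2)[OF E_hol _ a]) (rule E_pos)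
  have "h z \<le> 4 / pi * arctan ((1 + cmod (disk_involution a z)) / (1 - cmod (disk_involution a z))
      * tan (strip_angle \<bar>b\<bar> / 2)) - 1" if z: "cmod z < 1" for z
  proof -
    define r where "r = cmod (disk_involution a z)"
    have r: "0 \<le> r" "r < 1"
      using disk_involution_in_disk[OF a z] by (auto simp: r_def)
    have "strip_angle (h z) \<le> 2 * arctan ((1 + r) / (1 - r) * tan (strip_angle b / 2))"
      using schwarz_pick[OF z] strip_angle_bounds[OF assms(2)]
      unfolding E_polar[OF z] Ea r_def[symmetric]
      by (intro angle_bound_in_pseudohyperbolic_disk[OF angle[OF z] _ _ R r]) auto
    also have "\<dots> \<le> 2 * arctan ((1 + r) / (1 - r) * tan (strip_angle \<bar>b\<bar> / 2))"
      using tan_half_strip_angle_le_abs[OF assms(2)] r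
      by (intro mult_left_mono arctan_monotone') auto
    finally show ?thesis
      unfolding r_def[symmetric] strip_angle_def[of "h z"] by (simp add: field_simps)
  qed
  moreover have "onorm (frechet_derivative h (at a)) \<le> 4 / pi * (sin (strip_angle \<bar>b\<bar>) / (1 - (cmod a)\<^sup>2))"
  proof -
    have dF: "(F has_field_derivative deriv F a) (at a)"
      using holomorphic_derivI[OF F] assms(1) by simp
    have "((\<lambda>z. Re (F z)) has_derivative (\<lambda>v. Re (deriv F a * v))) (at a)"
      using bounded_linear.has_derivative[OF bounded_linear_Re dF[unfolded has_field_derivative_def]] .
    then have "(h has_derivative (\<lambda>v. Re (deriv F a * v))) (at a)"
      by (rule has_derivative_transform_within_open[OF _ open_ball assms(1)]) (rule ReF)
    then have dh: "frechet_derivative h (at a) = (\<lambda>v. Re (deriv F a * v))"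
      using frechet_derivative_at by metis
    have "onorm (frechet_derivative h (at a)) \<le> cmod (deriv F a)"
      unfolding dh
    proof (rule onorm_le)
      show "norm (Re (deriv F a * v)) \<le> cmod (deriv F a) * norm v" for v
        using abs_Re_le_cmod[of "deriv F a * v"] by (simp add: norm_mult)
    qed
    also have "cmod (deriv F a) \<le> 4 / pi * (sin (strip_angle \<bar>b\<bar>) / (1 - (cmod a)\<^sup>2))"
    proof -
      have "(E has_field_derivative E a * (\<i> * of_real (pi / 2) * deriv F a)) (at a)"
        unfolding E_def by (auto intro!: derivative_eq_intros dF)
      then have "cmod (deriv E a) = cmod (E a * (\<i> * of_real (pi / 2) * deriv F a))"
        using DERIV_imp_deriv by metis
      also have "\<dots> = pi / 2 * cmod (deriv F a)"
        unfolding Ea by (simp add: norm_mult)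
      finally have deriv_E: "cmod (deriv E a) = pi / 2 * cmod (deriv F a)" .
      have "pi / 2 * cmod (deriv F a) * (1 - (cmod a)\<^sup>2) \<le> 2 * sin (strip_angle \<bar>b\<bar>)"
        using schwarz_pick_deriv unfolding deriv_E Ea sin_strip_angle_abs by simp
      moreover have "1 - (cmod a)\<^sup>2 > 0"
        using a by (simp add: power_less_one_iff)
      ultimately show ?thesis
        by (simp add: field_simps)
    qed
    finally show ?thesis .
  qed
  ultimately show ?thesis
    by simp
qed

end
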